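(* Let $n,m\ge 1$ be integers, let $W=(W_1,\ldots,W_n)$ be the output of one uniform, unbiased $m$-shelf shuffle of $n$ cards, and let $\mathbb P_{n,m},\mathbb E_{n,m}$ denote probability and expectation in this model. Then the direction-tracking strategy $G$ satisfies $$\mathbb E_{n,m}C_G=\max_{A\in\mathcal A_n}\mathbb E_{n,m}C_A .$$ More precisely, for every $0\le k<n$ and every history $h=(w_1,\ldots,w_k)$ with $\mathbb P_{n,m}(W_1=w_1,\ldots,W_k=w_k)>0$, with remaining set $R=[n]\setminus\{w_1,\ldots,w_k\}$, we have $$G(h)\in\operatorname*{arg\,max}_{c\in R}\ \mathbb P_{n,m}(W_{k+1}=c\mid W_1=w_1,\ldots,W_k=w_k),$$ where for the empty history ($k=0$) the probability on the right is the unconditional probability $\mathbb P_{n,m}(W_1=c)$.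
   Context: Write $[n]=\{1,\ldots,n\}$. Shelf-shuffling model. The $n$ distinct cards are initially arranged in the order $1,\ldots,n$ from top to bottom. Cards are removed successively from the bottom, so they are processed in the order $n,n-1,\ldots,1$. Each card independently chooses one of $m$ shelves uniformly at random and is then, independently, placed on the top or on the bottom of the current pile on that shelf, with probability $1/2$ each. Finally the $m$ piles are concatenated in a fixed shelf order (shelf 1 on top, then shelf 2, and so on), giving the output permutation $W=(W_1,\ldots,W_n)$, read from top to bottom. Complete feedback. In round $j$ ($1\le j\le n$) the player guesses $W_j$ using the previously revealed cards $W_1,\ldots,W_{j-1}$, and is then shown $W_j$ whether or not the guess was correct. $\mathcal A_n$ is the class of all complete-feedback strategies: the guess $A_j\in[n]$ in round $j$ is a function of $(W_1,\ldots,W_{j-1})$ and possibly of an auxiliary random variable $U$ independent of $W$ (deterministic strategies are included; cards may be guessed repeatedly). The number of correct guesses is $C_A=\sum_{j=1}^n\mathbf 1_{\{A_j=W_j\}}$. Direction-tracking strategy $G$. A history of length $k<n$ is a sequence $h=(w_1,\ldots,w_k)$ of distinct elements of $[n]$, and $R=[n]\setminus\{w_1,\ldots,w_k\}$. Let $G(h)$ denote the guess in round $k+1$ after $h$. For the empty history, $G(\varnothing)=1$. For $k\ge1$ put $L=w_k$, $R_-=\{r\in R: r<L\}$, $R_+=\{r\in R: r>L\}$. The current direction is upward if $k=1$; for $k\ge2$ it is upward if $w_{k-1}<w_k$ and downward if $w_{k-1}>w_k$. Then - if upward: $G(h)=\min R_+$ if $R_+\neq\varnothing$, and $G(h)=\max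 R_-$ if $R_+=\varnothing$; - if downward: $G(h)=\max R_-$ if $R_-\neq\varnothing$, and $G(h)=\min R_+$ if $R_-=\varnothing$. *)

theory Defs
  imports "HOL-Probability.Probability" "HOL-Probability.Product_PMF"
begin

text \<open>
  The choice of a card is a pair (shelf, b), where b says whether the card goes on the top
  (rather than the bottom) of the pile on that shelf.  Piles and decks are lists read from
  top to bottom.
\<close>

definition place_card ::
    "(nat \<Rightarrow> nat \<times> bool) \<Rightarrow> nat \<Rightarrow> (nat \<Rightarrow> nat list) \<Rightarrow> (nat \<Rightarrow> nat list)" where
  "place_card choice c piles =
     (case choice c of (s, b) \<Rightarrow> piles(s := (if b then c # piles s else piles s @ [c])))"

definition shelf_output :: "nat \<Rightarrow> nat \<Rightarrow> (nat \<Rightarrow> nat \<times> bool) \<Rightarrow> nat list" where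
  "shelf_output n m choice =
     (let piles = fold (place_card choice) (rev [1..<Suc n]) (\<lambda>_. [])
      in concat (map piles [1..<Suc m]))"

definition shelf_choices :: "nat \<Rightarrow> nat \<Rightarrow> (nat \<Rightarrow> nat \<times> bool) pmf" where
  "shelf_choices n m =
     Pi_pmf {1..n} undefined (\<lambda>_. pair_pmf (pmf_of_set {1..m}) (bernoulli_pmf (1/2)))"

definition shelf_shuffle :: "nat \<Rightarrow> nat \<Rightarrow> nat list pmf" where
  "shelf_shuffle n m = map_pmf (shelf_output n m) (shelf_choices n m)"

definition histories :: "nat \<Rightarrow> nat list set" where
  "histories n = {h. length h < n \<and> distinct h \<and> set h \<subseteq> {1..n}}"

text \<open>
  A strategy consists of the law of the auxiliary random variable \<open>U\<close> together with the
  guess as a function of the history and of the value of \<open>U\<close>.  Guesses are constrained to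
  \<open>{1..n}\<close> on histories only; measurability is required for all lists, so that the number
  of correct guesses is measurable on the whole product space.
\<close>

type_synonym 'u strategy = "'u measure \<times> (nat list \<Rightarrow> 'u \<Rightarrow> nat)"

definition strategies :: "nat \<Rightarrow> 'u strategy set" where
  "strategies n = {(D, A). prob_space D \<and>
     (\<forall>h. A h \<in> measurable D (count_space UNIV)) \<and>
     (\<forall>h\<in>histories n. \<forall>u\<in>space D. A h u \<in> {1..n})}"

text \<open>A deterministic strategy ignores \<open>U\<close>, which is then taken to be constant.\<close>

definition deterministic :: "(nat list \<Rightarrow> nat) \<Rightarrow> 'u strategy" where
  "deterministic g = (return (count_space UNIV) undefined, \<lambda>h _. g h)"

text \<open>
  Lists are indexed from 0, so the card \<open>W\<^sub>j\<close> is \<open>w ! (j - 1)\<close>, and it is guessed after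
  seeing \<open>take (j - 1) w\<close>.
\<close>

definition correct_guesses :: "nat \<Rightarrow> (nat list \<Rightarrow> nat) \<Rightarrow> nat list \<Rightarrow> real" where
  "correct_guesses n g w = (\<Sum>j=1..n. of_bool (g (take (j - 1) w) = w ! (j - 1)))"

text \<open>Independence of \<open>W\<close> and \<open>U\<close>: their joint law is the product measure.\<close>

definition expected_correct :: "nat \<Rightarrow> nat \<Rightarrow> 'u strategy \<Rightarrow> real" where
  "expected_correct n m = (\<lambda>(D, A).
     \<integral>(w, u). correct_guesses n (\<lambda>h. A h u) w \<partial>(measure_pmf (shelf_shuffle n m) \<Otimes>\<^sub>M D))"

definition upward :: "nat list \<Rightarrow> bool" where
  "upward h \<longleftrightarrow> length h = 1 \<or> h ! (length h - 2) < h ! (length h - 1)"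

definition direction_tracking :: "nat \<Rightarrow> nat list \<Rightarrow> nat" where
  "direction_tracking n h =
     (if h = [] then 1
      else let R = {1..n} - set h;
               L = last h;
               Rminus = {r \<in> R. r < L};
               Rplus = {r \<in> R. r > L}
           in if upward h
              then (if Rplus \<noteq> {} then Min Rplus else Max Rminus)
              else (if Rminus \<noteq> {} then Max Rminus else Min Rplus))"

end

theory Submission
  imports Defs
begin

text \<open>
  A card going on top of its pile ends above all cards already there, and one going to the
  bottom below them.  Since the cards come in the order \<open>n, \<dots>, 1\<close>, each final pile is an
  increasing run (the cards placed on top) followed by a decreasing run (those placed at the
  bottom).  So a shuffle assigns the cards independently and uniformly to \<open>M = 2 m\<close> half-piles,
  which are increasing and decreasing in turn.  Call \<open>level\<close> of a half-pile the number of
  half-piles below it in the deck.  Levels go down from \<open>M - 1\<close> to \<open>0\<close> along the deck; odd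
  levels are increasing and even ones decreasing.  All probabilities are thus counts of level
  assignments divided by \<open>M ^ n\<close>.

  Fix a history \<open>h\<close> with last card \<open>L\<close> and remaining set \<open>R\<close>, and give levels to the cards of \<open>h\<close>.
  If a card \<open>c \<in> R\<close> comes next and has level \<open>y\<close>, the other remaining cards can be given levels in
  \<open>weight y a b\<close> ways, where \<open>a\<close> and \<open>b\<close> count the cards of \<open>R\<close> below and above \<open>c\<close>.  The admissible
  \<open>y\<close> are all those below the level \<open>x\<close> of \<open>L\<close>, and \<open>x\<close> itself if \<open>c\<close> lies on the side of \<open>L\<close> to which
  level \<open>x\<close> runs.  Hence the number of continuations is the partial sum \<open>cum_weight k a b\<close>, with
  \<open>k = x + 1\<close> or \<open>k = x\<close>.  Two facts about these sums carry the proof.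

  \<^item> Consecutive weights combine so that \<open>cum_weight k\<close> decreases in the rank of \<open>c\<close> for even \<open>k\<close>
    (\<open>cum_weight_even_antimono\<close>) and increases for odd \<open>k\<close> (\<open>cum_weight_odd_mono\<close>).
  \<^item> The weights increase with \<open>y\<close>, so \<open>cum_weight k\<close> is convex in \<open>k\<close> (\<open>cum_weight_convex\<close>).

  The player does not see \<open>x\<close>, and for a single \<open>x\<close> the best guess may go against the current
  direction.  But changing the level of \<open>L\<close> from \<open>2 t + 1\<close> to \<open>2 t\<close> or back keeps an upward history
  consistent, and exchanging \<open>2 t + 1\<close> with \<open>2 t + 2\<close> keeps a downward one consistent
  (\<open>flip_last_history_levels\<close>).  Both levels of such a pair are thus equally likely, and it is
  enough to compare their sums.  In an upward history the pair contributes
  \<open>cum_weight (2 t) + cum_weight (2 t + 2)\<close> for \<open>c > L\<close> and \<open>2 * cum_weight (2 t + 1)\<close> for \<open>c < L\<close>.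
  By monotonicity both are largest next to \<open>L\<close>, and by convexity the side above \<open>L\<close> wins if
  it is not empty (\<open>continuations_upward_pair\<close>).  The downward case is the mirror image, except
  that level \<open>0\<close> is left over; it runs downward and is the last one, so that only cards below
  \<open>L\<close> can follow.

  So the tracking guess maximizes the probability of every prefix \<open>h @ [c]\<close>.  What a player has
  guessed does not affect what is revealed, so the expected number of correct guesses is a
  sum over histories of such prefix probabilities, and maximizing each term separately is
  optimal.
\<close>

section \<open>The deck as an ordered list\<close>

text \<open>
  The order of the deck, for a card \<open>c\<close> of level \<open>x\<close> and a card \<open>d\<close> of level \<open>y\<close>.  For a fixed
  assignment of levels this is a strict total order on the cards.
\<close>

definition precedes :: "nat \<Rightarrow> nat \<Rightarrow> nat \<Rightarrow> nat \<Rightarrow> bool" where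
  "precedes x c y d \<longleftrightarrow> y < x \<or> (y = x \<and> (if odd x then c < d else d < c))"

definition ordered :: "(nat \<Rightarrow> nat) \<Rightarrow> nat list \<Rightarrow> bool" where
  "ordered f = sorted_wrt (\<lambda>c d. precedes (f c) c (f d) d)"

text \<open>
  The bottom half of pile \<open>s\<close> has the \<open>2 * (m - s)\<close> half-piles of the later shelves below it, the
  top half has one more.
\<close>

definition level :: "nat \<Rightarrow> nat \<times> bool \<Rightarrow> nat" where
  "level m sb = 2 * (m - fst sb) + of_bool (snd sb)"

lemma precedes_trans: "precedes x c y d \<Longrightarrow> precedes y d z e \<Longrightarrow> precedes x c z e"
  by (auto simp: precedes_def split: if_splits)

lemma precedes_asym: "precedes x c y d \<Longrightarrow> \<not> precedes y d x c"
  by (auto simp: precedes_def split: if_splits)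

lemma ordered_snoc:
  "ordered f (h @ [c]) \<longleftrightarrow>
     ordered f h \<and> (h \<noteq> [] \<longrightarrow> precedes (f (last h)) (last h) (f c) c)"
proof (cases h rule: rev_cases)
  case (snoc h' L)
  then show ?thesis
    by (auto simp: ordered_def sorted_wrt_append intro: precedes_trans)
qed (simp add: ordered_def)

lemma ordered_cong:
  "(\<And>x. x \<in> set h \<Longrightarrow> f x = g x) \<Longrightarrow> ordered f h \<longleftrightarrow> ordered g h"
  unfolding ordered_def
  by (intro iffI; rule sorted_wrt_mono_rel[rotated], assumption) auto

lemma ordered_distinct: "ordered f w \<Longrightarrow> distinct w"
  unfolding ordered_def by (induction w) (auto dest: precedes_asym)

lemma ordered_unique:
  "ordered f w \<Longrightarrow> ordered f w' \<Longrightarrow> set w = set w' \<Longrightarrow> w = w'"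
proof (induction w arbitrary: w')
  case (Cons x xs)
  obtain y ys where w': "w' = y # ys"
    using Cons.prems(3) by (cases w') auto
  have "x = y"
  proof (rule ccontr)
    assume "x \<noteq> y"
    with Cons.prems(3) have "x \<in> set ys" "y \<in> set xs" by (auto simp: w')
    with Cons.prems(1,2) show False
      by (auto simp: w' ordered_def dest: precedes_asym)
  qed
  moreover have "x \<notin> set xs" "y \<notin> set ys"
    using Cons.prems(1,2)[THEN ordered_distinct] by (auto simp: w')
  ultimately have "set xs = set ys"
    using Cons.prems(3) by (auto simp: w')
  with Cons.IH[of ys] Cons.prems(1,2) \<open>x = y\<close> show ?case
    by (simp add: w' ordered_def)
qed auto

text \<open>
  Being a prefix of the deck becomes a condition on levels alone: the sorted enumeration of
  the cards is unique, so it begins with \<open>cs\<close> as soon as \<open>cs\<close> is sorted and its last element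
  precedes everything else.
\<close>

lemma ordered_take_iff:
  assumes w: "ordered f w" and cs: "distinct cs" "set cs \<subseteq> set w" "cs \<noteq> []"
  shows "take (length cs) w = cs \<longleftrightarrow>
     ordered f cs \<and> (\<forall>r \<in> set w - set cs. precedes (f (last cs)) (last cs) (f r) r)"
    (is "?l \<longleftrightarrow> ?r")
proof
  assume ?l
  then obtain rest where w_eq: "w = cs @ rest"
    by (metis append_take_drop_id)
  with w ordered_distinct[OF w] show ?r
    using cs(3) by (auto simp: ordered_def sorted_wrt_append)
next
  assume r: ?r
  define rest where "rest = filter (\<lambda>r. r \<notin> set cs) w"
  have rest: "ordered f rest"
    using w unfolding rest_def ordered_def by (rule sorted_wrt_filter)
  have "precedes (f c) c (f d) d" if "c \<in> set cs" "d \<in> set rest" for c d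
  proof -
    have "precedes (f (last cs)) (last cs) (f d) d"
      using r that(2) by (auto simp: rest_def)
    moreover have "c = last cs \<or> precedes (f c) c (f (last cs)) (last cs)"
      using r that(1) cs(3)
      by (cases cs rule: rev_cases) (auto simp: ordered_def sorted_wrt_append)
    ultimately show ?thesis by (auto intro: precedes_trans)
  qed
  with r rest have "ordered f (cs @ rest)"
    by (auto simp: ordered_def sorted_wrt_append)
  moreover have "set (cs @ rest) = set w"
    using cs(2) by (auto simp: rest_def)
  ultimately have "w = cs @ rest"
    using w by (metis ordered_unique)
  then show ?l by simp
qed

text \<open>
  The last card that is processed is the head of the list, and it ends at one of the two
  extremes of its pile.
\<close>

lemma foldr_place_card:
  "foldr (place_card ch) cs (\<lambda>_. []) s =
     filter (\<lambda>c. ch c = (s, True)) cs @ rev (filter (\<lambda>c. ch c = (s, False)) cs)"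
proof (induction cs arbitrary: s)
  case (Cons c cs)
  then show ?case
    by (cases "ch c") (auto simp: place_card_def)
qed simp

lemma shelf_output_eq:
  "shelf_output n m ch = concat (map (\<lambda>s. filter (\<lambda>c. ch c = (s, True)) [1..<Suc n] @
      rev (filter (\<lambda>c. ch c = (s, False)) [1..<Suc n])) [1..<Suc m])"
  unfolding shelf_output_def Let_def foldr_conv_fold[symmetric]
  by (intro arg_cong[where f = concat] map_cong refl foldr_place_card)

lemma set_shelf_output:
  assumes "\<And>c. c \<in> {1..n} \<Longrightarrow> fst (ch c) \<in> {1..m}"
  shows "set (shelf_output n m ch) = {1..n}"
proof -
  have "(\<exists>s\<in>{1..m}. ch c = (s, True) \<or> ch c = (s, False))" if "c \<in> {1..n}" for c
    using assms[OF that] by (cases "ch c") auto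
  then show ?thesis
    unfolding shelf_output_eq set_concat set_map set_upt
    by (auto simp del: upt_Suc simp: atLeastLessThanSuc_atLeastAtMost)
qed

lemma ordered_shelf_output:
  "ordered (\<lambda>c. level m (ch c)) (shelf_output n m ch)"
proof -
  define cs where "cs = [1..<Suc n]"
  let ?pile = "\<lambda>s. filter (\<lambda>c. ch c = (s, True)) cs @ rev (filter (\<lambda>c. ch c = (s, False)) cs)"
  have up: "sorted_wrt (<) cs" unfolding cs_def by (rule sorted_wrt_upt)
  have asc: "sorted_wrt (<) (filter P cs)" and desc: "sorted_wrt (>) (rev (filter P cs))" for P
    using sorted_wrt_filter[OF up] by (auto simp: sorted_wrt_rev)
  have pile: "ordered (\<lambda>c. level m (ch c)) (?pile s)" for s
    unfolding ordered_def sorted_wrt_append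
  proof (intro conjI ballI)
    show "sorted_wrt (\<lambda>c d. precedes (level m (ch c)) c (level m (ch d)) d)
        (filter (\<lambda>c. ch c = (s, True)) cs)"
      by (rule sorted_wrt_mono_rel[OF _ asc]) (auto simp: precedes_def level_def)
    show "sorted_wrt (\<lambda>c d. precedes (level m (ch c)) c (level m (ch d)) d)
        (rev (filter (\<lambda>c. ch c = (s, False)) cs))"
      by (rule sorted_wrt_mono_rel[OF _ desc]) (auto simp: precedes_def level_def)
  qed (auto simp: precedes_def level_def)
  have "ordered (\<lambda>c. level m (ch c)) (concat (map ?pile [1..<Suc k]))" if "k \<le> m" for k
    using that
  proof (induction k)
    case (Suc k)
    have "precedes (level m (ch c)) c (level m (ch d)) d"
      if "c \<in> set (concat (map ?pile [1..<Suc k]))" "d \<in> set (?pile (Suc k))" for c d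
      using that Suc.prems by (auto simp: precedes_def level_def simp del: upt_Suc)
    moreover have "[1..<Suc (Suc k)] = [1..<Suc k] @ [Suc k]" by simp
    moreover have "ordered (\<lambda>c. level m (ch c)) (concat (map ?pile [1..<Suc k]))"
      using Suc by simp
    ultimately show ?case
      using pile[of "Suc k"]
      by (simp only: ordered_def sorted_wrt_append map_append concat_append list.map concat.simps
          append_Nil2) blast
  qed (simp add: ordered_def)
  then show ?thesis unfolding shelf_output_eq cs_def by simp
qed

section \<open>Monotonicity and convexity of the weights\<close>

text \<open>
  If the next card has level \<open>y\<close>, a later card may have any of the levels below \<open>y\<close>, and also
  \<open>y\<close> itself if it lies above the next card (\<open>y\<close> odd) or below it (\<open>y\<close> even).
  The exponents \<open>a\<close> and \<open>b\<close> stand for the numbers of later cards below and above the next card.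
\<close>

definition weight :: "nat \<Rightarrow> nat \<Rightarrow> nat \<Rightarrow> nat" where
  "weight y a b = (if odd y then y ^ a * (y + 1) ^ b else (y + 1) ^ a * y ^ b)"

definition cum_weight :: "nat \<Rightarrow> nat \<Rightarrow> nat \<Rightarrow> nat" where
  "cum_weight k a b = (\<Sum>y<k. weight y a b)"

lemma cum_weight_Suc: "cum_weight (Suc k) a b = cum_weight k a b + weight k a b"
  by (simp add: cum_weight_def)

lemma weight_mono: "weight y a b \<le> weight (Suc y) a b"
proof (cases "odd y")
  case True
  have "y ^ a \<le> (y + 2) ^ a" by (rule power_mono) auto
  then show ?thesis using True
    by (simp add: weight_def mult.commute)
next
  case False
  have "y ^ b \<le> (y + 2) ^ b" by (rule power_mono) auto
  then show ?thesis using False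
    by (simp add: weight_def)
qed

lemma cum_weight_convex:
  "2 * cum_weight (Suc k) a b \<le> cum_weight (Suc (Suc k)) a b + cum_weight k a b"
  using weight_mono[of k a b] by (simp add: cum_weight_Suc)

text \<open>
  By \<open>y ^ b \<le> (y + 2) ^ b\<close>: replacing one factor \<open>y + 1\<close> in both terms by \<open>y\<close> and \<open>y + 2\<close> loses the
  smaller power once and gains the larger one once.
\<close>

lemma power_pair_le:
  "(y + 1) ^ Suc a * (y ^ b + (y + 2) ^ b) \<le> (y + 1) ^ a * (y ^ Suc b + (y + 2) ^ Suc b)"
  for y :: nat
proof -
  have "y ^ b \<le> (y + 2) ^ b" by (rule power_mono) auto
  then have "(y + 1) * (y ^ b + (y + 2) ^ b) \<le> y ^ Suc b + (y + 2) ^ Suc b"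
    by (simp add: algebra_simps)
  then have "(y + 1) ^ a * ((y + 1) * (y ^ b + (y + 2) ^ b))
      \<le> (y + 1) ^ a * (y ^ Suc b + (y + 2) ^ Suc b)"
    by (rule mult_left_mono) simp
  then show ?thesis by (simp only: power_Suc2 mult.assoc)
qed

text \<open>
  Here the levels \<open>2 t\<close> and \<open>2 t + 1\<close> are grouped: they share the base \<open>2 t + 1\<close> for the cards below,
  and raising the rank trades a factor \<open>2 t\<close> or \<open>2 t + 2\<close> for this base, at a loss in total.
\<close>

lemma cum_weight_even_step: "cum_weight (2 * t) (Suc a) b \<le> cum_weight (2 * t) a (Suc b)"
proof (induction t)
  case (Suc t)
  have "weight (2 * t) (Suc a) b + weight (Suc (2 * t)) (Suc a) b
      \<le> weight (2 * t) a (Suc b) + weight (Suc (2 * t)) a (Suc b)"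
    using power_pair_le[of "2 * t" a b] by (simp add: weight_def distrib_left del: power_Suc)
  with Suc show ?case by (simp add: cum_weight_Suc)
qed (simp add: cum_weight_def)

text \<open>
  Now level \<open>0\<close> stands alone and the levels \<open>2 t + 1\<close> and \<open>2 t + 2\<close> are grouped.  They share the
  base \<open>2 t + 2\<close> for the cards above, which reverses the direction of the inequality.
\<close>

lemma cum_weight_odd_step:
  "cum_weight (Suc (2 * t)) a (Suc b) \<le> cum_weight (Suc (2 * t)) (Suc a) b"
proof (induction t)
  case (Suc t)
  have "weight (Suc (2 * t)) a (Suc b) + weight (Suc (Suc (2 * t))) a (Suc b)
      \<le> weight (Suc (2 * t)) (Suc a) b + weight (Suc (Suc (2 * t))) (Suc a) b"
    using power_pair_le[of "Suc (2 * t)" b a]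
    by (simp add: weight_def distrib_left mult.commute del: power_Suc)
  with Suc show ?case by (simp add: cum_weight_Suc)
qed (simp add: cum_weight_def weight_def)

lemma cum_weight_even_antimono:
  assumes "a \<le> a'" "a + b = a' + b'"
  shows "cum_weight (2 * t) a' b' \<le> cum_weight (2 * t) a b"
proof -
  obtain d where "a' = a + d" using assms(1) le_Suc_ex by blast
  with assms(2) have "b = b' + d" by simp
  have "cum_weight (2 * t) (a + d) b' \<le> cum_weight (2 * t) a (b' + d)" for d
  proof (induction d arbitrary: b')
    case (Suc d)
    from cum_weight_even_step[of t "a + d" b'] Suc.IH[of "Suc b'"] show ?case by simp
  qed simp
  then show ?thesis by (simp add: \<open>a' = a + d\<close> \<open>b = b' + d\<close>)
qed

lemma cum_weight_odd_mono:
  assumes "a \<le> a'" "a + b = a' + b'"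
  shows "cum_weight (Suc (2 * t)) a b \<le> cum_weight (Suc (2 * t)) a' b'"
proof -
  obtain d where "a' = a + d" using assms(1) le_Suc_ex by blast
  with assms(2) have "b = b' + d" by simp
  have "cum_weight (Suc (2 * t)) a (b' + d) \<le> cum_weight (Suc (2 * t)) (a + d) b'" for d
  proof (induction d arbitrary: b')
    case (Suc d)
    from cum_weight_odd_step[of t "a + d" b'] Suc.IH[of "Suc b'"] show ?case by simp
  qed simp
  then show ?thesis by (simp add: \<open>a' = a + d\<close> \<open>b = b' + d\<close>)
qed

section \<open>Counting level assignments\<close>

lemma precedes_levels:
  assumes "x < M" "c \<noteq> d"
  shows "{y. y < M \<and> precedes x c y d} = {..<if odd x \<longleftrightarrow> c < d then Suc x else x}"
  using assms by (auto simp: precedes_def split: if_splits)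

definition history_levels :: "nat \<Rightarrow> nat list \<Rightarrow> (nat \<Rightarrow> nat) set" where
  "history_levels M h = {g \<in> set h \<rightarrow>\<^sub>E {..<M}. ordered g h}"

text \<open>
  The assignments of levels to all cards for which the deck begins with \<open>cs\<close>.
\<close>

definition prefix_levels :: "nat \<Rightarrow> nat \<Rightarrow> nat list \<Rightarrow> (nat \<Rightarrow> nat) set" where
  "prefix_levels n M cs = {f \<in> {1..n} \<rightarrow>\<^sub>E {..<M}.
     ordered f cs \<and> (\<forall>r\<in>{1..n} - set cs. precedes (f (last cs)) (last cs) (f r) r)}"

lemma finite_history_levels: "finite (history_levels M h)"
  unfolding history_levels_def by (simp add: finite_PiE)

lemma card_completions:
  fixes g :: "nat \<Rightarrow> nat"
  assumes h: "set h \<subseteq> {1..n}" and c: "c \<in> {1..n} - set h" and y: "y < M"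
  defines "T \<equiv> \<lambda>z. if z \<in> set h then {g z} else if z = c then {y}
                    else {x. x < M \<and> precedes y c x z}"
  shows "card (PiE {1..n} T) =
     weight y (card {r \<in> {1..n} - set h. r < c}) (card {r \<in> {1..n} - set h. c < r})"
proof -
  \<comment> \<open>Every factor other than 1 belongs to a remaining card either below or above \<open>c\<close>.\<close>
  have "card (T z) = (if z \<notin> set h \<and> z < c then (if odd y then y else Suc y) else 1) *
      (if z \<notin> set h \<and> c < z then (if odd y then Suc y else y) else 1)" for z
    using c y precedes_levels[OF y, of c z]
    by (cases "z \<in> set h"; cases z c rule: linorder_cases) (simp_all add: T_def)
  then have "card (PiE {1..n} T) =
      (\<Prod>z\<in>{1..n}. if z \<notin> set h \<and> z < c then (if odd y then y else Suc y) else 1) *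
      (\<Prod>z\<in>{1..n}. if z \<notin> set h \<and> c < z then (if odd y then Suc y else y) else 1)"
    by (simp only: card_PiE finite_atLeastAtMost prod.distrib)
  also have "\<dots> = (\<Prod>z\<in>{r \<in> {1..n}. r \<notin> set h \<and> r < c}. if odd y then y else Suc y) *
      (\<Prod>z\<in>{r \<in> {1..n}. r \<notin> set h \<and> c < r}. if odd y then Suc y else y)"
    by (simp only: prod.inter_filter finite_atLeastAtMost)
  also have "{r \<in> {1..n}. r \<notin> set h \<and> r < c} = {r \<in> {1..n} - set h. r < c}" by auto
  also have "{r \<in> {1..n}. r \<notin> set h \<and> c < r} = {r \<in> {1..n} - set h. c < r}" by auto
  finally show ?thesis
    by (simp add: weight_def)
qed

text \<open>
  The assignments are classified by their restriction to the history and by the level of the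
  next card.  Once these are fixed, the constraints on the other cards are independent of
  each other, so that each class is a product set.
\<close>

lemma card_prefix_levels:
  assumes h: "set h \<subseteq> {1..n}" and c: "c \<in> {1..n} - set h"
  shows "card (prefix_levels n M (h @ [c])) =
     (\<Sum>g\<in>history_levels M h. \<Sum>y\<in>{y. y < M \<and> (h \<noteq> [] \<longrightarrow> precedes (g (last h)) (last h) y c)}.
        weight y (card {r \<in> {1..n} - set h. r < c}) (card {r \<in> {1..n} - set h. c < r}))"
proof -
  define Y where "Y g = {y. y < M \<and> (h \<noteq> [] \<longrightarrow> precedes (g (last h)) (last h) y c)}" for g
  \<comment> \<open>The levels allowed for each single card, given the levels \<open>g\<close> of the history and \<open>y\<close> of \<open>c\<close>.\<close>
  define T where "T g y = (\<lambda>z. if z \<in> set h then {g z} else if z = c then {y}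
                    else {x. x < M \<and> precedes y c x z})" for g :: "nat \<Rightarrow> nat" and y
  define I where "I = Sigma (history_levels M h) Y"
  have ord: "ordered f (h @ [c]) \<longleftrightarrow> ordered g h \<and> (h \<noteq> [] \<longrightarrow> precedes (g (last h)) (last h) (f c) c)"
    if "\<And>z. z \<in> set h \<Longrightarrow> f z = g z" for f g
    using ordered_cong[of h f g] that by (auto simp: ordered_snoc)
  define X where "X i = PiE {1..n} (T (fst i) (snd i))" for i
  have "prefix_levels n M (h @ [c]) = \<Union> (X ` I)"
  proof (intro equalityI subsetI)
    fix f assume f: "f \<in> prefix_levels n M (h @ [c])"
    define g where "g = restrict f (set h)"
    have "ordered g h \<and> (h \<noteq> [] \<longrightarrow> precedes (g (last h)) (last h) (f c) c)"
      using ord[of f g] f by (auto simp: g_def prefix_levels_def)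
    with f h c have "(g, f c) \<in> I"
      by (auto simp: I_def Y_def history_levels_def prefix_levels_def g_def PiE_iff subset_iff)
    moreover have "f \<in> X (g, f c)"
      using f by (auto simp: X_def prefix_levels_def T_def g_def PiE_iff)
    ultimately show "f \<in> \<Union> (X ` I)" by blast
  next
    fix f assume "f \<in> \<Union> (X ` I)"
    then obtain g y where gy: "g \<in> history_levels M h" "y \<in> Y g" and f: "f \<in> PiE {1..n} (T g y)"
      by (auto simp: I_def X_def)
    have fz: "f z \<in> T g y z" if "z \<in> {1..n}" for z using f that by (rule PiE_mem)
    have fh: "f z = g z" if "z \<in> set h" for z
      using fz[of z] that h by (auto simp: T_def)
    have fc: "f c = y" using fz[of c] c by (auto simp: T_def)
    have frest: "f z < M \<and> precedes y c (f z) z" if "z \<in> {1..n} - insert c (set h)" for z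
      using fz[of z] that by (auto simp: T_def)
    have fM: "f z < M" if "z \<in> {1..n}" for z
      using fh[of z] fc frest[of z] gy that
      by (cases "z \<in> set h"; cases "z = c") (auto simp: history_levels_def Y_def)
    have "ordered f (h @ [c])"
      using ord[OF fh] gy fc by (auto simp: history_levels_def Y_def)
    then show "f \<in> prefix_levels n M (h @ [c])"
      using f fM frest fc by (auto simp: prefix_levels_def PiE_iff)
  qed
  also have "card \<dots> = (\<Sum>i\<in>I. card (X i))"
  proof (rule card_UN_disjoint)
    show "finite I" by (auto simp: I_def Y_def finite_history_levels)
    show "\<forall>i\<in>I. finite (X i)"
      by (auto simp: X_def T_def intro!: finite_PiE)
    have "(g, y) = (g', y')"
      if g: "g \<in> history_levels M h" "g' \<in> history_levels M h" and f: "f \<in> X (g, y)" "f \<in> X (g', y')"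
      for g g' y y' f
    proof -
      have fz: "f z \<in> T g y z" "f z \<in> T g' y' z" if "z \<in> {1..n}" for z
        using PiE_mem[OF _ that] f by (simp_all add: X_def)
      have "g z = g' z" if "z \<in> set h" for z
        using fz[of z] that h by (auto simp: T_def)
      then have "g = g'"
        using g by (intro extensionalityI[of _ "set h"]) (auto simp: history_levels_def PiE_iff)
      moreover have "y = y'" using fz[of c] c by (auto simp: T_def)
      ultimately show ?thesis by simp
    qed
    then have "i = j" if "i \<in> I" "j \<in> I" "f \<in> X i" "f \<in> X j" for i j f
      using that unfolding I_def by (metis SigmaE)
    then show "\<forall>i\<in>I. \<forall>j\<in>I. i \<noteq> j \<longrightarrow> X i \<inter> X j = {}" by blast
  qed
  also have "\<dots> = (\<Sum>g\<in>history_levels M h. \<Sum>y\<in>Y g. card (PiE {1..n} (T g y)))"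
    unfolding I_def X_def by (subst sum.Sigma) (auto simp: finite_history_levels Y_def split_def)
  also have "\<dots> = (\<Sum>g\<in>history_levels M h. \<Sum>y\<in>Y g.
      weight y (card {r \<in> {1..n} - set h. r < c}) (card {r \<in> {1..n} - set h. c < r}))"
    unfolding T_def by (intro sum.cong refl card_completions assms) (simp add: Y_def)
  finally show ?thesis unfolding Y_def .
qed

section \<open>Comparing the candidates for the next card\<close>

definition rank_weight :: "nat \<Rightarrow> nat set \<Rightarrow> nat \<Rightarrow> nat" where
  "rank_weight k R c = cum_weight k (card {r \<in> R. r < c}) (card {r \<in> R. c < r})"

text \<open>
  The number of continuations with next card \<open>c\<close>, when the last card \<open>L\<close> has level \<open>x\<close>: the next
  card may share this level exactly if it lies on the side of \<open>L\<close> to which level \<open>x\<close> runs.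
\<close>

definition continuations :: "nat \<Rightarrow> nat set \<Rightarrow> nat \<Rightarrow> nat \<Rightarrow> nat" where
  "continuations L R x c = rank_weight (if odd x \<longleftrightarrow> L < c then Suc x else x) R c"

lemma card_prefix_levels_Nil:
  assumes "c \<in> {1..n}"
  shows "card (prefix_levels n M [c]) = rank_weight M {1..n} c"
proof -
  have "history_levels M [] = {\<lambda>_. undefined}"
    by (auto simp: history_levels_def ordered_def)
  then show ?thesis
    using card_prefix_levels[of "[]" n c M] assms
    by (simp add: rank_weight_def cum_weight_def lessThan_def)
qed

lemma card_prefix_levels_snoc:
  assumes "set h \<subseteq> {1..n}" "c \<in> {1..n} - set h" "h \<noteq> []"
  shows "card (prefix_levels n M (h @ [c])) =
     (\<Sum>g\<in>history_levels M h. continuations (last h) ({1..n} - set h) (g (last h)) c)"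
proof -
  have "{y. y < M \<and> (h \<noteq> [] \<longrightarrow> precedes (g (last h)) (last h) y c)} =
      {..<if odd (g (last h)) \<longleftrightarrow> last h < c then Suc (g (last h)) else g (last h)}"
    if "g \<in> history_levels M h" for g
  proof -
    have "g (last h) < M" "last h \<noteq> c"
      using that assms by (auto simp: history_levels_def)
    from precedes_levels[OF this] show ?thesis using assms(3) by simp
  qed
  then show ?thesis
    unfolding card_prefix_levels[OF assms(1,2)] continuations_def rank_weight_def cum_weight_def
    by (intro sum.cong) auto
qed

text \<open>
  The numbers of cards below and above an element of \<open>R\<close> have a constant sum, so a larger
  element has more cards below and correspondingly fewer above.
\<close>

lemma
  assumes R: "finite R" "c \<in> R" "d \<in> R" and le: "c \<le> d"
  shows rank_weight_even: "rank_weight (2 * t) R d \<le> rank_weight (2 * t) R c"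
    and rank_weight_odd: "rank_weight (Suc (2 * t)) R c \<le> rank_weight (Suc (2 * t)) R d"
proof -
  have others: "card {r \<in> R. r < e} + card {r \<in> R. e < r} = card (R - {e})" if "e \<in> R" for e
  proof -
    have "R - {e} = {r \<in> R. r < e} \<union> {r \<in> R. e < r}" by (auto simp: neq_iff)
    also have "card \<dots> = card {r \<in> R. r < e} + card {r \<in> R. e < r}"
      using R(1) by (intro card_Un_disjoint) auto
    finally show ?thesis ..
  qed
  have below: "card {r \<in> R. r < c} \<le> card {r \<in> R. r < d}"
    using R le by (intro card_mono) auto
  have total: "card {r \<in> R. r < c} + card {r \<in> R. c < r} =
      card {r \<in> R. r < d} + card {r \<in> R. d < r}"
    using R others[of c] others[of d] by simp
  show "rank_weight (2 * t) R d \<le> rank_weight (2 * t) R c"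
    and "rank_weight (Suc (2 * t)) R c \<le> rank_weight (Suc (2 * t)) R d"
    unfolding rank_weight_def
    by (rule cum_weight_even_antimono[OF below total] cum_weight_odd_mono[OF below total])+
qed

lemma rank_weight_convex:
  "2 * rank_weight (Suc k) R c \<le> rank_weight (Suc (Suc k)) R c + rank_weight k R c"
  unfolding rank_weight_def by (rule cum_weight_convex)

text \<open>
  For \<open>c > L\<close> both partial sums have even length and favour the smallest such \<open>c\<close>.  For \<open>c < L\<close> they
  coincide and have odd length, and so favour large ranks; even extended to the rank of the
  candidate above \<open>L\<close>, they do not exceed its count by convexity.
\<close>

lemma continuations_upward_pair:
  assumes R: "finite R" "L \<notin> R" "c \<in> R"
  defines "b \<equiv> if {r \<in> R. L < r} \<noteq> {} then Min {r \<in> R. L < r} else Max {r \<in> R. r < L}"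
  shows "continuations L R (2 * t) c + continuations L R (Suc (2 * t)) c
       \<le> continuations L R (2 * t) b + continuations L R (Suc (2 * t)) b"
proof (cases "{r \<in> R. L < r} = {}")
  case True
  with R have "\<not> L < c" "c \<noteq> L" by auto
  then have cL: "c < L" by simp
  define A where "A = {r \<in> R. r < L}"
  have "c \<in> A" "A \<noteq> {}" "finite A" using R cL by (auto simp: A_def)
  moreover have "b = Max A" using True by (simp add: b_def A_def)
  ultimately have "b \<in> A" "c \<le> b" using Max_in[of A] by auto
  then have "b \<in> R" "b < L" "c \<le> b" by (auto simp: A_def)
  with cL R rank_weight_odd[of R c b t] show ?thesis
    by (auto simp: continuations_def)
next
  case False
  with R have b: "b \<in> R" "L < b" and least: "\<And>r. r \<in> R \<Longrightarrow> L < r \<Longrightarrow> b \<le> r"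
    using Min_in[of "{r \<in> R. L < r}"] by (auto simp: b_def)
  show ?thesis
  proof (cases "L < c")
    case True
    with R b least[of c] rank_weight_even[of R b c t] rank_weight_even[of R b c "Suc t"]
    show ?thesis by (simp add: continuations_def)
  next
    case False
    with R have "c \<le> b" using b by auto
    with False R b rank_weight_odd[of R c b t] rank_weight_convex[of "2 * t" R b]
    show ?thesis by (simp add: continuations_def)
  qed
qed

text \<open>
  The mirror image of the upward case.  Level \<open>0\<close> remains without a partner; it is decreasing
  and has no level below it, so it only admits cards below \<open>L\<close> and agrees with the current direction by itself.
\<close>

lemma continuations_downward_pair:
  assumes R: "finite R" "L \<notin> R" "c \<in> R"
  defines "b \<equiv> if {r \<in> R. r < L} \<noteq> {} then Max {r \<in> R. r < L} else Min {r \<in> R. L < r}"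
  shows "continuations L R (Suc (2 * t)) c + continuations L R (Suc (Suc (2 * t))) c
       \<le> continuations L R (Suc (2 * t)) b + continuations L R (Suc (Suc (2 * t))) b" (is ?pair)
    and "continuations L R 0 c \<le> continuations L R 0 b" (is ?zero)
proof -
  have "?pair \<and> ?zero"
  proof (cases "{r \<in> R. r < L} = {}")
    case True
    with R have "\<not> c < L" "c \<noteq> L" by auto
    then have Lc: "L < c" by simp
    define A where "A = {r \<in> R. L < r}"
    have "c \<in> A" "A \<noteq> {}" "finite A" using R Lc by (auto simp: A_def)
    moreover have "b = Min A" using True by (simp add: b_def A_def)
    ultimately have "b \<in> A" "b \<le> c" using Min_in[of A] by auto
    then have "b \<in> R" "L < b" "b \<le> c" by (auto simp: A_def)
    with Lc R rank_weight_even[of R b c "Suc t"] show ?thesis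
      by (auto simp: continuations_def rank_weight_def cum_weight_def)
  next
    case False
    with R have b: "b \<in> R" "b < L" and greatest: "\<And>r. r \<in> R \<Longrightarrow> r < L \<Longrightarrow> r \<le> b"
      using Max_in[of "{r \<in> R. r < L}"] by (auto simp: b_def)
    show ?thesis
    proof (cases "L < c")
      case True
      then have "b \<le> c" using b by auto
      with True R b rank_weight_even[of R b c "Suc t"] rank_weight_convex[of "Suc (2 * t)" R b]
      show ?thesis by (simp add: continuations_def rank_weight_def[of 0] cum_weight_def[of 0])
    next
      case False
      moreover have "c \<noteq> L" using R by auto
      ultimately have "c < L" by simp
      with False R b greatest[of c] rank_weight_odd[of R c b 0] rank_weight_odd[of R c b t]
        rank_weight_odd[of R c b "Suc t"]
      show ?thesis by (simp add: continuations_def)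
    qed
  qed
  then show ?pair ?zero by auto
qed

text \<open>
  Both sums are unchanged when their terms are permuted by \<open>\<tau>\<close>, so twice each sum is a sum over
  the pairs \<open>g\<close>, \<open>\<tau> g\<close>.
\<close>

lemma sum_mono_involution:
  fixes \<phi> \<psi> :: "'a \<Rightarrow> nat"
  assumes "\<And>g. g \<in> A \<Longrightarrow> \<tau> g \<in> A" "\<And>g. g \<in> A \<Longrightarrow> \<tau> (\<tau> g) = g"
    and le: "\<And>g. g \<in> A \<Longrightarrow> \<phi> g + \<phi> (\<tau> g) \<le> \<psi> g + \<psi> (\<tau> g)"
  shows "sum \<phi> A \<le> sum \<psi> A"
proof -
  have double: "2 * sum f A = (\<Sum>g\<in>A. f g + f (\<tau> g))" for f :: "'a \<Rightarrow> nat"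
  proof -
    have "(\<Sum>g\<in>A. f (\<tau> g)) = sum f A"
      by (rule sum.reindex_bij_witness[of _ \<tau> \<tau>]) (use assms in auto)
    then show ?thesis by (simp add: sum.distrib)
  qed
  have "2 * sum \<phi> A \<le> 2 * sum \<psi> A"
    unfolding double by (rule sum_mono) (rule le)
  then show ?thesis by simp
qed

text \<open>
  The pairings of levels for upward and for downward histories.  Truncated subtraction makes
  level \<open>0\<close> a fixed point of the second one.
\<close>

definition flip_up :: "nat \<Rightarrow> nat" where
  "flip_up x = (if odd x then x - 1 else Suc x)"

definition flip_down :: "nat \<Rightarrow> nat" where
  "flip_down x = (if odd x then Suc x else x - 1)"

lemma flip_flip: "flip_up (flip_up x) = x" "flip_down (flip_down x) = x"
  by (auto simp: flip_up_def flip_down_def)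

text \<open>
  Let the card before \<open>L\<close>, if any, have level \<open>x'\<close>.  If it is smaller than \<open>L\<close>, the level \<open>x\<close> of \<open>L\<close> is only
  constrained by \<open>x \<le> x'\<close> with equality only for odd \<open>x'\<close>, and this does not separate \<open>2 t + 1\<close> from \<open>2 t\<close>.
  If it is larger, equality needs an even \<open>x'\<close> instead, which does not separate \<open>2 t + 2\<close> from
  \<open>2 t + 1\<close>; this also keeps \<open>x\<close> off the topmost level \<open>M - 1\<close>, whose partner would be \<open>M\<close>.
\<close>

lemma flip_last_history_levels:
  assumes h: "h \<noteq> []" "distinct h" and M: "even M" and g: "g \<in> history_levels M h"
  defines "\<sigma> \<equiv> if upward h then flip_up else flip_down"
  shows "g(last h := \<sigma> (g (last h))) \<in> history_levels M h"
proof -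
  obtain h' L where hL: "h = h' @ [L]" using h(1) by (cases h rule: rev_cases) auto
  define x where "x = g L"
  have x: "x < M" and ord: "ordered g h'"
    and pre: "h' \<noteq> [] \<longrightarrow> precedes (g (last h')) (last h') x L"
    using g by (auto simp: history_levels_def hL ordered_snoc x_def PiE_iff)
  have gM: "h' \<noteq> [] \<longrightarrow> g (last h') < M"
    using g by (auto simp: history_levels_def hL PiE_iff)
  have Lh': "L \<notin> set h'" using h(2) by (simp add: hL)
  have up: "upward h \<longleftrightarrow> h' = [] \<or> last h' < L"
    by (cases h' rule: rev_cases) (auto simp: upward_def hL nth_append)
  have "\<sigma> x < M \<and> (h' \<noteq> [] \<longrightarrow> precedes (g (last h')) (last h') (\<sigma> x) L)"
  proof (cases "upward h")
    case True
    have "\<sigma> x < M"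
      using True x M by (auto simp: \<sigma>_def flip_up_def elim!: evenE oddE)
    moreover have "precedes (g (last h')) (last h') (\<sigma> x) L" if "h' \<noteq> []"
      using that pre True up
      by (auto simp: \<sigma>_def flip_up_def precedes_def elim!: evenE oddE split: if_splits) presburger
    ultimately show ?thesis by blast
  next
    case False
    with up have h': "h' \<noteq> []" "L < last h'"
      using Lh' by (auto simp: not_less le_less)
    with pre have "x < g (last h') \<or> (x = g (last h') \<and> even x)"
      by (auto simp: precedes_def split: if_splits)
    then show ?thesis
    proof (cases "odd x")
      case True
      with \<open>x < g (last h') \<or> x = g (last h') \<and> even x\<close> have "Suc x \<le> g (last h')" by auto
      then have "Suc x < g (last h') \<or> g (last h') = Suc x" by auto
      with True h' False gM x show ?thesis
        by (auto simp: \<sigma>_def flip_down_def precedes_def)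
    next
      case even: False
      with \<open>x < g (last h') \<or> x = g (last h') \<and> even x\<close> h' False x show ?thesis
        by (auto simp: \<sigma>_def flip_down_def precedes_def)
    qed
  qed
  moreover have "ordered (g(L := \<sigma> x)) h' \<longleftrightarrow> ordered g h'"
    using Lh' by (intro ordered_cong) auto
  moreover have "h' \<noteq> [] \<longrightarrow> last h' \<noteq> L" using Lh' by auto
  ultimately show ?thesis
    using g ord by (auto simp: history_levels_def hL ordered_snoc x_def PiE_iff extensional_def)
qed

lemma direction_tracking_mem:
  assumes "h \<in> histories n"
  shows "direction_tracking n h \<in> {1..n} - set h"
proof -
  define R where "R = {1..n} - set h"
  have "card (set h) < n" using assms by (auto simp: histories_def distinct_card)
  then have "R \<noteq> {}"
    using card_mono[of "set h" "{1..n}"] by (auto simp: R_def)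
  show ?thesis
  proof (cases "h = []")
    case True
    with assms show ?thesis by (auto simp: histories_def direction_tracking_def)
  next
    case False
    let ?A = "{r \<in> R. r < last h}" and ?B = "{r \<in> R. last h < r}"
    have "last h \<notin> R" using False by (simp add: R_def)
    moreover have "R = ?A \<union> {r \<in> R. r = last h} \<union> ?B" by (auto simp: neq_iff)
    ultimately have "?A \<noteq> {} \<or> ?B \<noteq> {}" using \<open>R \<noteq> {}\<close> by blast
    moreover have "?A \<noteq> {} \<Longrightarrow> Max ?A \<in> R" "?B \<noteq> {} \<Longrightarrow> Min ?B \<in> R"
      using Max_in[of ?A] Min_in[of ?B] by (auto simp: R_def)
    ultimately have "direction_tracking n h \<in> R"
      unfolding direction_tracking_def Let_def R_def[symmetric] using False by auto
    then show ?thesis by (simp add: R_def)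
  qed
qed

text \<open>
  For the empty history every level is possible, and \<open>cum_weight M\<close> with even \<open>M\<close> favours the
  smallest card.  Otherwise the counts are averaged over the two levels of the last card that
  are exchanged by the pairing for the current direction.
\<close>

lemma direction_tracking_maximizes:
  assumes h: "h \<in> histories n" and M: "even M" and c: "c \<in> {1..n} - set h"
  shows "card (prefix_levels n M (h @ [c])) \<le> card (prefix_levels n M (h @ [direction_tracking n h]))"
proof (cases "h = []")
  case True
  from M obtain t where "M = 2 * t" by blast
  with c True show ?thesis
    using rank_weight_even[of "{1..n}" 1 c t]
    by (simp add: card_prefix_levels_Nil direction_tracking_def)
next
  case False
  define R L b where "R = {1..n} - set h" and "L = last h" and "b = direction_tracking n h"
  have R: "finite R" "L \<notin> R" "c \<in> R"
    using False c by (auto simp: R_def L_def)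
  have sub: "set h \<subseteq> {1..n}" and dist: "distinct h" using h by (auto simp: histories_def)
  define \<sigma> where "\<sigma> = (if upward h then flip_up else flip_down)"
  have pair: "continuations L R x c + continuations L R (\<sigma> x) c
      \<le> continuations L R x b + continuations L R (\<sigma> x) b" for x
  proof (cases "upward h")
    case True
    have b: "b = (if {r \<in> R. L < r} \<noteq> {} then Min {r \<in> R. L < r} else Max {r \<in> R. r < L})"
      using True False unfolding b_def direction_tracking_def Let_def R_def L_def by simp
    show ?thesis
    proof (cases "odd x")
      case odd: True
      then obtain t where "x = Suc (2 * t)" by (auto elim: oddE)
      then show ?thesis using True continuations_upward_pair[OF R, of t]
        by (simp add: b \<sigma>_def flip_up_def)
    next
      case even: False
      then obtain t where "x = 2 * t" by auto
      then show ?thesis using True continuations_upward_pair[OF R, of t]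
        by (simp add: b \<sigma>_def flip_up_def)
    qed
  next
    case down: False
    have b: "b = (if {r \<in> R. r < L} \<noteq> {} then Max {r \<in> R. r < L} else Min {r \<in> R. L < r})"
      using down False unfolding b_def direction_tracking_def Let_def R_def L_def by simp
    consider "x = 0" | t where "x = Suc (2 * t)" | t where "x = Suc (Suc (2 * t))"
      by (metis evenE oddE Suc_eq_plus1 not0_implies_Suc even_Suc mult_0_right)
    then show ?thesis
    proof cases
      case 1
      then show ?thesis using down continuations_downward_pair(2)[OF R]
        by (simp add: b \<sigma>_def flip_down_def)
    next
      case 2
      then show ?thesis using down continuations_downward_pair(1)[OF R, of t]
        by (simp add: b \<sigma>_def flip_down_def)
    next
      case 3
      then show ?thesis using down continuations_downward_pair(1)[OF R, of t]
        by (simp add: b \<sigma>_def flip_down_def)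
    qed
  qed
  have "(\<Sum>g\<in>history_levels M h. continuations L R (g L) c) \<le> (\<Sum>g\<in>history_levels M h. continuations L R (g L) b)"
  proof (rule sum_mono_involution[where \<tau> = "\<lambda>g. g(L := \<sigma> (g L))"])
    fix g assume "g \<in> history_levels M h"
    then show "g(L := \<sigma> (g L)) \<in> history_levels M h"
      using flip_last_history_levels[OF False dist M] by (simp add: L_def \<sigma>_def)
  next
    fix g :: "nat \<Rightarrow> nat"
    show "(g(L := \<sigma> (g L)))(L := \<sigma> ((g(L := \<sigma> (g L))) L)) = g"
      by (simp add: \<sigma>_def flip_flip)
  next
    fix g :: "nat \<Rightarrow> nat"
    show "continuations L R (g L) c + continuations L R ((g(L := \<sigma> (g L))) L) c
       \<le> continuations L R (g L) b + continuations L R ((g(L := \<sigma> (g L))) L) b"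
      using pair[of "g L"] by simp
  qed
  then show ?thesis
    using card_prefix_levels_snoc[OF sub _ False] c direction_tracking_mem[OF h]
    by (simp add: R_def L_def b_def)
qed

section \<open>From counts to probabilities\<close>

lemma bij_betw_level:
  assumes "m \<ge> 1"
  shows "bij_betw (level m) ({1..m} \<times> UNIV) {..<2 * m}"
proof (rule bij_betwI[where g = "\<lambda>x. (m - x div 2, odd x)"])
  show "level m \<in> {1..m} \<times> UNIV \<rightarrow> {..<2 * m}"
    by (auto simp: level_def)
  show "(\<lambda>x. (m - x div 2, odd x)) \<in> {..<2 * m} \<rightarrow> {1..m} \<times> UNIV"
    by auto
qed (auto simp: level_def elim!: oddE)

lemma levels_uniform:
  assumes "m \<ge> 1"
  shows "map_pmf (\<lambda>ch. restrict (\<lambda>c. level m (ch c)) {1..n}) (shelf_choices n m) =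
     pmf_of_set ({1..n} \<rightarrow>\<^sub>E {..<2 * m})"
proof -
  let ?S = "{1..m} \<times> (UNIV :: bool set)"
  have "pair_pmf (pmf_of_set {1..m}) (bernoulli_pmf (1/2)) = pmf_of_set ?S"
    using assms by (intro pmf_eqI) (auto simp: pmf_pair indicator_def split: prod.splits)
  moreover have "map_pmf (level m) (pmf_of_set ?S) = pmf_of_set {..<2 * m}"
    using assms by (intro map_pmf_of_set_bij_betw bij_betw_level) auto
  ultimately have level: "map_pmf (level m) (pair_pmf (pmf_of_set {1..m}) (bernoulli_pmf (1/2))) =
      pmf_of_set {..<2 * m}" by simp
  have "map_pmf (\<lambda>ch. restrict (\<lambda>c. level m (ch c)) {1..n}) (shelf_choices n m) =
      map_pmf (\<lambda>f x. if x \<in> {1..n} then f x else undefined)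
        (map_pmf (\<lambda>ch. level m \<circ> ch) (shelf_choices n m))"
    by (simp add: map_pmf_comp restrict_def o_def)
  also have "\<dots> = Pi_pmf {1..n} undefined (\<lambda>_. pmf_of_set {..<2 * m})"
    unfolding shelf_choices_def
    by (subst Pi_pmf_map[symmetric]) (simp_all only: level finite_atLeastAtMost Pi_pmf_default_swap)
  also have "\<dots> = pmf_of_set (PiE_dflt {1..n} undefined (\<lambda>_. {..<2 * m}))"
    using assms by (intro Pi_pmf_of_set) (auto simp: lessThan_empty_iff)
  also have "PiE_dflt {1..n} undefined (\<lambda>_. {..<2 * m}) = {1..n} \<rightarrow>\<^sub>E {..<2 * m}"
    unfolding PiE_dflt_def PiE_def Pi_def extensional_def by blast
  finally show ?thesis .
qed

lemma shelf_choices_range: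
  assumes "m \<ge> 1" "ch \<in> set_pmf (shelf_choices n m)" "c \<in> {1..n}"
  shows "fst (ch c) \<in> {1..m}"
proof -
  have "ch c \<in> {1..m} \<times> UNIV"
    using assms by (auto simp: shelf_choices_def set_Pi_pmf PiE_dflt_def)
  then show ?thesis by (simp add: mem_Times_iff)
qed

lemma shelf_shuffle_permutes:
  assumes "m \<ge> 1" "w \<in> set_pmf (shelf_shuffle n m)"
  shows "distinct w" "set w = {1..n}" "length w = n"
proof -
  obtain ch where ch: "ch \<in> set_pmf (shelf_choices n m)" and w: "w = shelf_output n m ch"
    using assms(2) by (auto simp: shelf_shuffle_def)
  show *: "distinct w" "set w = {1..n}"
    unfolding w using ordered_distinct[OF ordered_shelf_output]
      set_shelf_output[OF shelf_choices_range[OF assms(1) ch]] by auto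
  show "length w = n" using distinct_card[OF *(1)] *(2) by simp
qed

lemma prob_prefix:
  assumes m: "m \<ge> 1" and cs: "distinct cs" "set cs \<subseteq> {1..n}" "cs \<noteq> []"
  shows "measure_pmf.prob (shelf_shuffle n m) {w. take (length cs) w = cs} =
     card (prefix_levels n (2 * m) cs) / (2 * m) ^ n"
proof -
  let ?f = "\<lambda>ch. restrict (\<lambda>c. level m (ch c)) {1..n}"
  have *: "take (length cs) (shelf_output n m ch) = cs \<longleftrightarrow> ?f ch \<in> prefix_levels n (2 * m) cs"
    if ch: "ch \<in> set_pmf (shelf_choices n m)" for ch
  proof -
    have set: "set (shelf_output n m ch) = {1..n}"
      using shelf_choices_range[OF m ch] by (rule set_shelf_output)
    have "?f ch \<in> set_pmf (map_pmf ?f (shelf_choices n m))"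
      using ch by auto
    then have f: "?f ch \<in> {1..n} \<rightarrow>\<^sub>E {..<2 * m}"
      unfolding levels_uniform[OF m] using m by (subst (asm) set_pmf_of_set) (auto simp: finite_PiE PiE_eq_empty_iff lessThan_empty_iff)
    have "ordered (?f ch) (shelf_output n m ch)"
      using ordered_shelf_output[of m ch n] set
        ordered_cong[of "shelf_output n m ch" "?f ch" "\<lambda>c. level m (ch c)"] by simp
    from ordered_take_iff[OF this cs(1)] cs(2,3) set f show ?thesis
      by (simp add: prefix_levels_def)
  qed
  have "measure_pmf.prob (shelf_shuffle n m) {w. take (length cs) w = cs} =
      measure_pmf.prob (shelf_choices n m) {ch. take (length cs) (shelf_output n m ch) = cs}"
    by (simp add: shelf_shuffle_def vimage_def)
  also have "\<dots> = measure_pmf.prob (shelf_choices n m) {ch. ?f ch \<in> prefix_levels n (2 * m) cs}"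
    using * by (intro measure_pmf.finite_measure_eq_AE) (auto simp: AE_measure_pmf_iff)
  also have "\<dots> = measure_pmf.prob (map_pmf ?f (shelf_choices n m)) (prefix_levels n (2 * m) cs)"
    by (simp add: vimage_def)
  also have "\<dots> = card (({1..n} \<rightarrow>\<^sub>E {..<2 * m}) \<inter> prefix_levels n (2 * m) cs) /
      card ({1..n} \<rightarrow>\<^sub>E {..<2 * m})"
    unfolding levels_uniform[OF m] using m
    by (intro measure_pmf_of_set) (auto simp: finite_PiE PiE_eq_empty_iff lessThan_empty_iff)
  also have "({1..n} \<rightarrow>\<^sub>E {..<2 * m}) \<inter> prefix_levels n (2 * m) cs = prefix_levels n (2 * m) cs"
    by (auto simp: prefix_levels_def)
  finally show ?thesis by (simp add: card_PiE)
qed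

text \<open>
  Cards that have already been seen can be admitted as guesses here, since they have
  probability zero; this covers strategies that guess cards repeatedly.
\<close>

lemma direction_tracking_best:
  assumes m: "m \<ge> 1" and h: "h \<in> histories n" and c: "c \<in> {1..n}"
  shows "measure_pmf.prob (shelf_shuffle n m) {w. take (Suc (length h)) w = h @ [c]}
       \<le> measure_pmf.prob (shelf_shuffle n m)
           {w. take (Suc (length h)) w = h @ [direction_tracking n h]}"
proof (cases "c \<in> set h")
  case True
  have "w \<notin> {w. take (Suc (length h)) w = h @ [c]}" if "w \<in> set_pmf (shelf_shuffle n m)" for w
    using distinct_take[OF shelf_shuffle_permutes(1)[OF m that], of "Suc (length h)"] True by auto
  then have "measure_pmf.prob (shelf_shuffle n m) {w. take (Suc (length h)) w = h @ [c]} = 0"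
    by (auto simp: measure_pmf_zero_iff)
  then show ?thesis by simp
next
  case False
  have prob: "measure_pmf.prob (shelf_shuffle n m) {w. take (Suc (length h)) w = h @ [d]} =
     card (prefix_levels n (2 * m) (h @ [d])) / (2 * m) ^ n" if "d \<in> {1..n} - set h" for d
    using prob_prefix[OF m, of "h @ [d]" n] that h by (auto simp: histories_def)
  show ?thesis
    using prob[of c] prob[OF direction_tracking_mem[OF h]]
      direction_tracking_maximizes[OF h, of "2 * m" c] False c
    by (simp add: divide_right_mono)
qed

section \<open>Optimality among all strategies\<close>

lemma finite_histories: "finite (histories n)"
  by (rule finite_subset[OF _ finite_lists_length_le[of "{1..n}" n]]) (auto simp: histories_def)

text \<open>
  Only the initial segments of \<open>w\<close> contribute to the sum over histories, each by the
  correctness of the guess that follows it.  Written in this way, the sum has an index set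
  that does not depend on \<open>w\<close>, and expectations can be taken termwise.
\<close>

lemma correct_guesses_histories:
  assumes w: "distinct w" "set w = {1..n}"
  shows "correct_guesses n g w =
     (\<Sum>h\<in>histories n. of_bool (take (Suc (length h)) w = h @ [g h]))"
proof -
  have len: "length w = n" using distinct_card[OF w(1)] w(2) by simp
  have inj: "inj_on (\<lambda>k. take k w) {..<n}"
    by (rule inj_on_inverseI[where g = length]) (simp add: len)
  have "correct_guesses n g w = (\<Sum>k<n. of_bool (g (take k w) = w ! k))"
    unfolding correct_guesses_def
    by (rule sum.reindex_bij_witness[of _ Suc "\<lambda>j. j - 1"]) auto
  also have "\<dots> = (\<Sum>k<n. of_bool (take (Suc k) w = take k w @ [g (take k w)]))"
    by (intro sum.cong) (auto simp: take_Suc_conv_app_nth len)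
  also have "\<dots> = (\<Sum>h\<in>(\<lambda>k. take k w) ` {..<n}. of_bool (take (Suc (length h)) w = h @ [g h]))"
    by (subst sum.reindex[OF inj]) (auto simp: len)
  also have "\<dots> = (\<Sum>h\<in>histories n. of_bool (take (Suc (length h)) w = h @ [g h]))"
  proof (rule sum.mono_neutral_left[OF finite_histories])
    show "(\<lambda>k. take k w) ` {..<n} \<subseteq> histories n"
      using w len by (auto simp: histories_def dest: in_set_takeD)
    have "h \<in> (\<lambda>k. take k w) ` {..<n}"
      if "h \<in> histories n" "take (Suc (length h)) w = h @ [g h]" for h
    proof (rule image_eqI[of _ _ "length h"])
      show "h = take (length h) w"
        using arg_cong[OF that(2), of "take (length h)"] by (simp add: min_def)
    qed (use that(1) in \<open>simp add: histories_def\<close>)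
    then show "\<forall>h\<in>histories n - (\<lambda>k. take k w) ` {..<n}.
        of_bool (take (Suc (length h)) w = h @ [g h]) = (0 :: real)" by auto
  qed
  finally show ?thesis .
qed

lemma integral_correct_guesses:
  assumes m: "m \<ge> 1"
  shows "(\<integral>w. correct_guesses n g w \<partial>measure_pmf (shelf_shuffle n m)) =
     (\<Sum>h\<in>histories n. measure_pmf.prob (shelf_shuffle n m) {w. take (Suc (length h)) w = h @ [g h]})"
proof -
  have "(\<integral>w. correct_guesses n g w \<partial>measure_pmf (shelf_shuffle n m)) =
      (\<integral>w. (\<Sum>h\<in>histories n. indicator {w. take (Suc (length h)) w = h @ [g h]} w)
        \<partial>measure_pmf (shelf_shuffle n m))"
    using shelf_shuffle_permutes[OF m]
    by (intro integral_cong_AE)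
      (auto simp: AE_measure_pmf_iff correct_guesses_histories indicator_def of_bool_def)
  also have "\<dots> = (\<Sum>h\<in>histories n.
      \<integral>w. indicator {w. take (Suc (length h)) w = h @ [g h]} w \<partial>measure_pmf (shelf_shuffle n m))"
    by (rule Bochner_Integration.integral_sum) (simp add: measure_pmf.emeasure_eq_measure)
  finally show ?thesis by simp
qed

text \<open>
  By Fubini's theorem a randomized strategy is an average of deterministic ones.
\<close>

lemma expected_correct_eq:
  fixes n m :: nat
  assumes A: "(D, A) \<in> strategies n"
  defines "E \<equiv> \<lambda>u. \<integral>w. correct_guesses n (\<lambda>h. A h u) w \<partial>measure_pmf (shelf_shuffle n m)"
  shows "integrable D E" "expected_correct n m (D, A) = (\<integral>u. E u \<partial>D)"
proof -
  let ?W = "measure_pmf (shelf_shuffle n m)"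
  interpret D: prob_space D using A by (simp add: strategies_def)
  interpret pair_prob_space ?W D ..
  have [measurable]: "A h \<in> measurable D (count_space UNIV)" for h
    using A by (simp add: strategies_def)
  let ?f = "\<lambda>(w, u). correct_guesses n (\<lambda>h. A h u) w"
  have "?f \<in> borel_measurable (count_space UNIV \<Otimes>\<^sub>M D)"
  proof (rule measurable_pair_measure_countable1)
    fix w :: "nat list"
    show "(\<lambda>u. ?f (w, u)) \<in> borel_measurable D"
      unfolding correct_guesses_def by simp
  qed simp
  then have meas: "?f \<in> borel_measurable (?W \<Otimes>\<^sub>M D)"
    by (simp cong: measurable_cong_sets sets_pair_measure_cong)
  have "integrable (?W \<Otimes>\<^sub>M D) ?f"
  proof (rule P.integrable_const_bound[where B = n])
    have "\<bar>correct_guesses n g w\<bar> \<le> n" for g w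
    proof -
      have "correct_guesses n g w \<le> (\<Sum>j=1..n. 1)"
        unfolding correct_guesses_def by (rule sum_mono) simp
      moreover have "0 \<le> correct_guesses n g w"
        unfolding correct_guesses_def by (rule sum_nonneg) simp
      ultimately show ?thesis by simp
    qed
    then show "AE x in ?W \<Otimes>\<^sub>M D. norm (?f x) \<le> n" by auto
  qed (rule meas)
  from integrable_snd[OF this] integral_snd[OF this]
  show "integrable D E" "expected_correct n m (D, A) = (\<integral>u. E u \<partial>D)"
    by (simp_all add: E_def expected_correct_def)
qed

lemma deterministic_strategy:
  assumes "\<And>h. h \<in> histories n \<Longrightarrow> g h \<in> {1..n}"
  shows "deterministic g \<in> strategies n"
  using assms by (auto simp: deterministic_def strategies_def prob_space_return)

text \<open>
  Conditioning on the history divides all prefix probabilities by the same number, so the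
  comparison of prefixes settles the second claim.  For the first, it is applied to each
  history and each value of the auxiliary variable.
\<close>

theorem theorem1p1:
  fixes n m :: nat
  assumes "n \<ge> 1" and "m \<ge> 1"
  shows "is_arg_max (expected_correct n m) (\<lambda>A. A \<in> (strategies n :: 'u strategy set))
           (deterministic (direction_tracking n)) \<and>
         (\<forall>h\<in>histories n.
            \<P>(w in shelf_shuffle n m. take (length h) w = h) > 0 \<longrightarrow>
            is_arg_max
              (\<lambda>c. \<P>(w in shelf_shuffle n m. w ! length h = c \<bar> take (length h) w = h))
              (\<lambda>c. c \<in> {1..n} - set h)
              (direction_tracking n h))"
proof (intro conjI ballI impI)
  let ?W = "measure_pmf (shelf_shuffle n m)"
  let ?E = "\<lambda>g. \<integral>w. correct_guesses n g w \<partial>?W"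
  let ?G = "direction_tracking n"
  have G: "deterministic ?G \<in> (strategies n :: 'u strategy set)"
    using direction_tracking_mem by (intro deterministic_strategy) auto
  have EG: "expected_correct n m (deterministic ?G :: 'u strategy) = ?E ?G"
    using expected_correct_eq(2)[of "return (count_space UNIV) undefined :: 'u measure" "\<lambda>h _. ?G h" n m] G
    by (simp add: deterministic_def measure_return)
  have "expected_correct n m S \<le> ?E ?G" if "S \<in> strategies n" for S :: "'u strategy"
  proof -
    obtain D A where S: "S = (D, A)" by (cases S)
    with that interpret D: prob_space D by (simp add: strategies_def)
    have "?E (\<lambda>h. A h u) \<le> ?E ?G" if "u \<in> space D" for u
      unfolding integral_correct_guesses[OF assms(2)]
      using \<open>S \<in> strategies n\<close> that
      by (intro sum_mono direction_tracking_best assms) (auto simp: S strategies_def)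
    then show ?thesis
      using expected_correct_eq[of D A n m] that
      by (auto simp: S intro!: D.integral_le_const)
  qed
  with G EG show "is_arg_max (expected_correct n m) (\<lambda>A. A \<in> (strategies n :: 'u strategy set))
           (deterministic ?G)"
    by (auto simp: is_arg_max_def not_less)
next
  fix h assume h: "h \<in> histories n"
  let ?W = "measure_pmf (shelf_shuffle n m)"
  have cond: "\<P>(w in ?W. w ! length h = c \<bar> take (length h) w = h) =
      measure ?W {w. take (Suc (length h)) w = h @ [c]} / measure ?W {w. take (length h) w = h}" for c
  proof -
    have "measure ?W {w. w ! length h = c \<and> take (length h) w = h} =
        measure ?W {w. take (Suc (length h)) w = h @ [c]}"
      using shelf_shuffle_permutes(3)[OF assms(2)] h
      by (intro measure_pmf.finite_measure_eq_AE)
        (auto simp: AE_measure_pmf_iff histories_def take_Suc_conv_app_nth)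
    then show ?thesis by (simp add: cond_prob_def)
  qed
  show "is_arg_max (\<lambda>c. \<P>(w in ?W. w ! length h = c \<bar> take (length h) w = h))
          (\<lambda>c. c \<in> {1..n} - set h) (direction_tracking n h)"
    unfolding cond
    using direction_tracking_mem[OF h] direction_tracking_best[OF assms(2) h]
    by (auto simp: is_arg_max_def not_less intro!: divide_right_mono)
qed

end
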